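(* Let $\Gamma$ be a finite simple graph with maximum degree $\Delta$ and algebraic connectivity $\mu$, and let $k$ be an integer. (i) If $\Gamma$ is partitionable into global defensive $k$-alliances, then $\psi_k^{gd}(\Gamma)\le \left\lfloor\Delta+1-\frac{\mu}{2}-k\right\rfloor$. (ii) If $\Gamma$ is partitionable into defensive $k$-alliances, then $a_k^d(\Gamma)\ge \left\lceil\frac{\mu+2(k+1)}{2}\right\rceil$.
   Context: Let $\Gamma=(V,E)$ be a finite simple graph with minimum degree $\delta$ and maximum degree $\Delta$. For $X\subseteq V$ and $v\in V$, $\delta_X(v)$ is the number of neighbors of $v$ in $X$; $\bar S=V\setminus S$. A nonempty set $S\subseteq V$ is a defensive $k$-alliance if $\delta_S(v)\ge\delta_{\bar S}(v)+k$ for every $v\in S$. It is global if moreover it is a dominating set, i.e. $\delta_S(u)>0$ for every $u\in\bar S$. $a_k^d(\Gamma)$ is the minimum cardinality of a defensive $k$-alliance in $\Gamma$ (when one exists). For $k\in\{-\Delta,\dots,\delta\}$, $\psi_k^{d}(\Gamma)$ (resp. $\psi_k^{gd}(\Gamma)$) is the maximum number of sets in a partition of $V$ such that each set is a defensive (resp. global defensive) $k$-alliance. $\Gamma$ is partitionable into defensive (resp. global defensive) $k$-alliances if $\psi_k^{d}(\Gamma)\ge 2$ (resp. $\psi_k^{gd}(\Gamma)\ge2$). The algebraic connectivity $\mu$ is the second smallest eigenvalue (counted with multiplicity) of the Laplacian matrix of $\Gamma$. *)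

theory Defs
  imports
    Complex_Main
    "HOL-Library.Multiset"
    "HOL-Library.Disjoint_Sets"
    "HOL-Computational_Algebra.Polynomial"
    "Graph_Theory.Pair_Digraph"
    "Jordan_Normal_Form.Char_Poly"
begin

text \<open>A finite simple graph is a \<^locale>\<open>pair_graph\<close>: a finite loop-free digraph with symmetric arc
  relation, each undirected edge being the two arcs \<open>(u, v)\<close> and \<open>(v, u)\<close>.\<close>

definition nbr_count :: "'a pair_pre_digraph \<Rightarrow> 'a set \<Rightarrow> 'a \<Rightarrow> nat" where
  "nbr_count G X v = card {u \<in> X. (v, u) \<in> parcs G}"

definition degree_of :: "'a pair_pre_digraph \<Rightarrow> 'a \<Rightarrow> nat" where
  "degree_of G v = nbr_count G (pverts G) v"

definition max_degree :: "'a pair_pre_digraph \<Rightarrow> nat" where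
  "max_degree G = Max (degree_of G ` pverts G)"


definition defensive_alliance :: "'a pair_pre_digraph \<Rightarrow> int \<Rightarrow> 'a set \<Rightarrow> bool" where
  "defensive_alliance G k S \<longleftrightarrow> S \<noteq> {} \<and> S \<subseteq> pverts G \<and>
     (\<forall>v\<in>S. int (nbr_count G S v) \<ge> int (nbr_count G (pverts G - S) v) + k)"

definition dominating_set :: "'a pair_pre_digraph \<Rightarrow> 'a set \<Rightarrow> bool" where
  "dominating_set G S \<longleftrightarrow> S \<subseteq> pverts G \<and> (\<forall>u\<in>pverts G - S. nbr_count G S u > 0)"

definition global_defensive_alliance :: "'a pair_pre_digraph \<Rightarrow> int \<Rightarrow> 'a set \<Rightarrow> bool" where
  "global_defensive_alliance G k S \<longleftrightarrow> defensive_alliance G k S \<and> dominating_set G S"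

text \<open>Meaningful only if some defensive \<open>k\<close>-alliance exists.\<close>
definition alliance_number :: "'a pair_pre_digraph \<Rightarrow> int \<Rightarrow> nat" where
  "alliance_number G k = Min {card S | S. defensive_alliance G k S}"

text \<open>In a finite graph the two suprema below range over finite sets of naturals, so they are
  maxima; if there is no partition of the required kind, their value is \<open>0\<close>.\<close>

definition psi_d :: "'a pair_pre_digraph \<Rightarrow> int \<Rightarrow> nat" where
  "psi_d G k = Sup {card P | P. partition_on (pverts G) P \<and> (\<forall>S\<in>P. defensive_alliance G k S)}"

definition psi_gd :: "'a pair_pre_digraph \<Rightarrow> int \<Rightarrow> nat" where
  "psi_gd G k =
     Sup {card P | P. partition_on (pverts G) P \<and> (\<forall>S\<in>P. global_defensive_alliance G k S)}"

definition partitionable_d :: "'a pair_pre_digraph \<Rightarrow> int \<Rightarrow> bool" where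
  "partitionable_d G k \<longleftrightarrow> psi_d G k \<ge> 2"

definition partitionable_gd :: "'a pair_pre_digraph \<Rightarrow> int \<Rightarrow> bool" where
  "partitionable_gd G k \<longleftrightarrow> psi_gd G k \<ge> 2"


text \<open>The rows and columns of the Laplacian matrix are indexed by an arbitrary enumeration of the
  vertices; another enumeration gives a similar matrix, hence the same characteristic polynomial.\<close>
definition vertex_list :: "'a pair_pre_digraph \<Rightarrow> 'a list" where
  "vertex_list G = (SOME vs. distinct vs \<and> set vs = pverts G)"

definition laplacian_matrix :: "'a pair_pre_digraph \<Rightarrow> real mat" where
  "laplacian_matrix G = (let vs = vertex_list G; n = length vs in
     mat n n (\<lambda>(i, j).
       if i = j then real (degree_of G (vs ! i))
       else if (vs ! i, vs ! j) \<in> parcs G then -1 else 0))"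

text \<open>Real eigenvalues with algebraic multiplicity, in increasing order. For a symmetric matrix these
  are all the eigenvalues, and algebraic and geometric multiplicities agree.\<close>
definition sorted_eigenvalues :: "real mat \<Rightarrow> real list" where
  "sorted_eigenvalues A = sorted_list_of_multiset (proots (char_poly A))"

text \<open>Meaningful only for graphs with at least two vertices; list positions start at \<open>0\<close>.\<close>
definition algebraic_connectivity :: "'a pair_pre_digraph \<Rightarrow> real" where
  "algebraic_connectivity G = sorted_eigenvalues (laplacian_matrix G) ! 1"

end

theory Submission
  imports Defs "HOL-Analysis.Function_Topology"
begin

text \<open>
  Write \<open>V\<close> for the vertex set, \<open>n\<close> for its size and \<open>\<mu>\<close> for the algebraic connectivity.
  Both bounds come from a single vertex of a small part of the given partition. Among at least two
  disjoint parts one has \<open>|S| \<le> n / 2\<close>, and Fiedler's cut bound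
  \<open>\<mu> |S| (n - |S|) \<le> n \<cdot> e(S, V - S)\<close>, where \<open>e\<close> counts the edges between two sets,
  says that the vertices of \<open>S\<close> have on average at least \<open>\<mu> (n - |S|) / n\<close>, hence at least
  \<open>\<mu> / 2\<close>, neighbours outside \<open>S\<close>. Some \<open>v \<in> S\<close> reaches this bound
  (\<open>ex_vertex_many_outside_nbrs\<close>). Let \<open>i\<close> and \<open>o\<close> count the neighbours of \<open>v\<close> inside and outside
  \<open>S\<close>, so that \<open>o \<ge> \<mu> / 2\<close>, and \<open>i \<ge> o + k\<close> because \<open>S\<close> is a defensive \<open>k\<close>-alliance.

  \<^item> In a partition into \<open>r\<close> global alliances every other part dominates \<open>v\<close>, so \<open>o \<ge> r - 1\<close> as well,
    and \<open>\<Delta> \<ge> i + o \<ge> 2 o + k \<ge> (r - 1) + \<mu> / 2 + k\<close>.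
  \<^item> If some partition into at least two alliances exists, a smallest alliance has at most \<open>n / 2\<close>
    vertices, so it can play the role of \<open>S\<close>, and \<open>|S| - 1 \<ge> i \<ge> o + k \<ge> \<mu> / 2 + k\<close>.

  The cut bound is the Rayleigh inequality \<open>\<mu> |x|\<^sup>2 \<le> x\<^sup>T L x\<close> for vectors \<open>x\<close> with coordinate sum
  \<open>0\<close>, applied to the indicator vector of \<open>S\<close> minus its mean. The full spectral theorem is avoided.
  By compactness the Rayleigh quotient attains a minimum \<open>\<lambda>\<close> on these vectors, and a minimiser \<open>w\<close>
  is an eigenvector for \<open>\<lambda>\<close> (\<open>rayleigh_minimiser_sum_zero\<close>). It remains to see that \<open>\<mu> \<le> \<lambda>\<close>.
  The constant vector and \<open>w\<close> are independent eigenvectors for \<open>0\<close> and \<open>\<lambda> \<ge> 0\<close>, and two independent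
  eigenvectors contribute two roots to the characteristic polynomial, counted with multiplicity
  (\<open>two_eigenvectors_char_poly_dvd\<close>). So at least two entries of the sorted list of roots are at
  most \<open>\<lambda>\<close>, and the second entry is one of them.
\<close>


section \<open>Minimising a quadratic form orthogonally to the constant vector\<close>

lemma linear_coeff_zero_if_quadratic_nonneg:
  fixes b c :: real
  assumes "\<And>t. 0 \<le> 2 * t * b + t^2 * c"
  shows "b = 0"
proof (rule ccontr)
  assume b: "b \<noteq> 0"
  \<comment> \<open>For small \<open>t\<close> of sign opposite to \<open>b\<close> the linear term dominates; \<open>t = - b / d\<close> is small enough.\<close>
  define d where "d = \<bar>c\<bar> + 1"
  have d: "d > 0" "c < d" by (auto simp: d_def)
  have "0 \<le> 2 * (- b / d) * b + (- b / d)^2 * c" by (rule assms)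
  also have "\<dots> = (b^2 / d^2) * (c - 2 * d)"
    using d by (simp add: field_simps power2_eq_square)
  also have "\<dots> < 0"
    using b d by (intro mult_pos_neg) auto
  finally show False by simp
qed

text \<open>
  Vectors indexed by a subset \<open>V\<close> of a type are functions that vanish off \<open>V\<close>. This makes the unit
  sphere a closed subset of a product of compact intervals, so Tychonoff's theorem applies.
\<close>

lemma compact_unit_vectors_sum_zero:
  fixes V :: "'a set"
  assumes fin: "finite V"
  shows "compact {x :: 'a \<Rightarrow> real.
    (\<forall>v. v \<notin> V \<longrightarrow> x v = 0) \<and> (\<Sum>v\<in>V. x v) = 0 \<and> (\<Sum>v\<in>V. (x v)^2) = 1}"
proof -
  define B where "B = PiE UNIV (\<lambda>v. if v \<in> V then {-1..1} else {0::real})"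
  have "compactin (product_topology (\<lambda>v. euclidean) UNIV) B"
    unfolding B_def by (subst compactin_PiE) auto
  then have B: "compact B"
    by (simp add: euclidean_product_topology)
  define C where "C = {x :: 'a \<Rightarrow> real. (\<Sum>v\<in>V. x v) = 0}"
  define D where "D = {x :: 'a \<Rightarrow> real. (\<Sum>v\<in>V. (x v)^2) = 1}"
  have C: "closed C" unfolding C_def
    by (intro closed_Collect_eq continuous_intros continuous_on_product_coordinates)
  have D: "closed D" unfolding D_def
    by (intro closed_Collect_eq continuous_intros continuous_on_product_coordinates)
  have bound: "-1 \<le> x v \<and> x v \<le> 1" if "(\<Sum>v\<in>V. (x v)^2) = 1" "v \<in> V" for x :: "'a \<Rightarrow> real" and v
  proof -
    have "(x v)^2 \<le> (\<Sum>v\<in>V. (x v)^2)"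
      using fin that by (intro member_le_sum) auto
    then have "\<bar>x v\<bar> \<le> 1" using that by (simp add: abs_square_le_1)
    then show ?thesis by linarith
  qed
  have "{x :: 'a \<Rightarrow> real. (\<forall>v. v \<notin> V \<longrightarrow> x v = 0) \<and> (\<Sum>v\<in>V. x v) = 0 \<and> (\<Sum>v\<in>V. (x v)^2) = 1}
    = B \<inter> (C \<inter> D)"
    using bound by (fastforce simp: B_def C_def D_def PiE_iff split: if_splits)
  then show ?thesis
    using compact_Int_closed[OF B closed_Int[OF C D]] by simp
qed

text \<open>
  The Rayleigh quotient attains its minimum \<open>l\<close> at some unit vector \<open>w\<close> with coordinate sum \<open>0\<close>.
  Let \<open>r = a w - l w\<close> be the residual. Since the rows of the symmetric matrix \<open>a\<close> sum to \<open>0\<close>, the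
  coordinates of \<open>r\<close> also sum to \<open>0\<close>, so \<open>w + t r\<close> is admissible for every real \<open>t\<close>. Minimality
  makes a quadratic polynomial in \<open>t\<close> with linear coefficient \<open>2 |r|\<^sup>2\<close> and no constant term
  nonnegative everywhere. Hence \<open>r = 0\<close>.
\<close>

lemma rayleigh_minimiser_sum_zero:
  fixes a :: "'a \<Rightarrow> 'a \<Rightarrow> real"
  assumes fin: "finite V" and two: "card V \<ge> 2"
    and sym: "\<And>u v. u \<in> V \<Longrightarrow> v \<in> V \<Longrightarrow> a u v = a v u"
    and rows: "\<And>u. u \<in> V \<Longrightarrow> (\<Sum>v\<in>V. a u v) = 0"
  shows "\<exists>w l. (\<Sum>v\<in>V. w v) = 0 \<and> (\<Sum>v\<in>V. (w v)^2) = 1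
    \<and> (\<forall>u\<in>V. (\<Sum>v\<in>V. a u v * w v) = l * w u)
    \<and> (\<forall>x. (\<Sum>v\<in>V. x v) = 0 \<longrightarrow>
          l * (\<Sum>v\<in>V. (x v)^2) \<le> (\<Sum>u\<in>V. \<Sum>v\<in>V. a u v * x u * x v))"
proof -
  define q where "q x = (\<Sum>u\<in>V. \<Sum>v\<in>V. a u v * x u * x v)" for x :: "'a \<Rightarrow> real"
  define nn where "nn x = (\<Sum>v\<in>V. (x v)^2)" for x :: "'a \<Rightarrow> real"
  define K where "K = {x :: 'a \<Rightarrow> real.
    (\<forall>v. v \<notin> V \<longrightarrow> x v = 0) \<and> (\<Sum>v\<in>V. x v) = 0 \<and> (\<Sum>v\<in>V. (x v)^2) = 1}"
  have K: "compact K" unfolding K_def by (rule compact_unit_vectors_sum_zero[OF fin])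
  have cont: "continuous_on K q" unfolding q_def
    by (intro continuous_intros continuous_on_subset[OF continuous_on_product_coordinates]) auto
  have normalise: "(\<lambda>v. if v \<in> V then x v / sqrt (nn x) else 0) \<in> K"
    if "(\<Sum>v\<in>V. x v) = 0" "nn x \<noteq> 0" for x
  proof -
    have pos: "nn x \<ge> 0" unfolding nn_def by (intro sum_nonneg) auto
    have "(\<Sum>v\<in>V. (x v / sqrt (nn x))^2) = nn x / (sqrt (nn x))^2"
      by (simp add: nn_def power_divide flip: sum_divide_distrib)
    then show ?thesis using that pos
      by (simp add: K_def flip: sum_divide_distrib)
  qed
  \<comment> \<open>The difference of two basis vectors shows that the constraint set is nonempty.\<close>
  obtain b c where bc: "b \<in> V" "c \<in> V" "b \<noteq> c"
    using two by (metis One_nat_def Suc_1 card_le_Suc0_iff_eq fin not_less_eq_eq)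
  define d where "d v = (if v = b then 1 else 0) - (if v = c then 1 else (0::real))" for v
  have "(\<Sum>v\<in>V. d v) = 0"
    using fin bc by (simp add: d_def sum_subtractf)
  moreover have "nn d \<noteq> 0"
  proof
    assume "nn d = 0"
    then have "d b = 0" using fin bc by (auto simp: nn_def sum_nonneg_eq_0_iff)
    then show False using bc by (simp add: d_def)
  qed
  ultimately have "K \<noteq> {}" using normalise by blast
  then obtain w where w: "w \<in> K" and min: "\<And>x. x \<in> K \<Longrightarrow> q w \<le> q x"
    using continuous_attains_inf[OF K _ cont] by blast
  define l where "l = q w"
  have w0: "(\<Sum>v\<in>V. w v) = 0" and w1: "nn w = 1" using w by (auto simp: K_def nn_def)
  have lower: "l * nn x \<le> q x" if x: "(\<Sum>v\<in>V. x v) = 0" for x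
  proof (cases "nn x = 0")
    case True
    then have "\<forall>v\<in>V. x v = 0" using fin by (simp add: nn_def sum_nonneg_eq_0_iff)
    then have "q x = 0" by (simp add: q_def)
    then show ?thesis using True by simp
  next
    case False
    have nonneg: "nn x \<ge> 0" unfolding nn_def by (intro sum_nonneg) auto
    have "q (\<lambda>v. if v \<in> V then x v / sqrt (nn x) else 0)
        = (\<Sum>u\<in>V. \<Sum>v\<in>V. a u v * x u * x v / nn x)"
      unfolding q_def using nonneg by (intro sum.cong refl) simp
    also have "\<dots> = q x / nn x"
      by (simp add: q_def sum_divide_distrib)
    finally have "l \<le> q x / nn x"
      using min[OF normalise[OF x False]] by (simp add: l_def)
    then show ?thesis
      using nonneg False by (simp add: pos_le_divide_eq)
  qed
  define r where "r u = (\<Sum>v\<in>V. a u v * w v) - l * w u" for u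
  have r0: "(\<Sum>u\<in>V. r u) = 0"
  proof -
    have "(\<Sum>u\<in>V. \<Sum>v\<in>V. a u v * w v) = (\<Sum>v\<in>V. (\<Sum>u\<in>V. a v u) * w v)"
      by (subst sum.swap) (simp add: sum_distrib_right sym)
    then show ?thesis
      by (simp add: r_def sum_subtractf rows w0 flip: sum_distrib_left)
  qed
  have expand: "q (\<lambda>v. w v + t * r v) - l * nn (\<lambda>v. w v + t * r v)
      = 2 * t * (\<Sum>u\<in>V. (r u)^2) + t^2 * (q r - l * nn r)" for t
  proof -
    define m where "m = (\<Sum>u\<in>V. r u * (\<Sum>v\<in>V. a u v * w v))"
    have m': "(\<Sum>u\<in>V. \<Sum>v\<in>V. a u v * w u * r v) = m"
      unfolding m_def sum_distrib_left
      by (subst sum.swap) (intro sum.cong refl, simp add: sym)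
    have m'': "(\<Sum>u\<in>V. \<Sum>v\<in>V. a u v * r u * w v) = m"
      unfolding m_def sum_distrib_left by (intro sum.cong refl) simp
    have "q (\<lambda>v. w v + t * r v)
        = (\<Sum>u\<in>V. \<Sum>v\<in>V. a u v * w u * w v + t * (a u v * w u * r v)
            + t * (a u v * r u * w v) + t^2 * (a u v * r u * r v))"
      unfolding q_def by (intro sum.cong refl) (simp add: algebra_simps power2_eq_square)
    also have "\<dots> = l + t * m + t * m + t^2 * q r"
      unfolding sum.distrib sum_distrib_left[symmetric] m' m'' by (simp add: q_def l_def)
    finally have 1: "q (\<lambda>v. w v + t * r v) = l + 2 * t * m + t^2 * q r" by simp
    have "nn (\<lambda>v. w v + t * r v)
        = (\<Sum>v\<in>V. (w v)^2 + 2 * t * (r v * w v) + t^2 * (r v)^2)"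
      unfolding nn_def by (intro sum.cong refl) (simp add: algebra_simps power2_eq_square)
    also have "\<dots> = 1 + 2 * t * (\<Sum>v\<in>V. r v * w v) + t^2 * nn r"
      unfolding sum.distrib sum_distrib_left[symmetric] using w1 by (simp add: nn_def)
    finally have 2: "nn (\<lambda>v. w v + t * r v) = 1 + 2 * t * (\<Sum>v\<in>V. r v * w v) + t^2 * nn r" .
    have 3: "(\<Sum>u\<in>V. (r u)^2) = m - l * (\<Sum>v\<in>V. r v * w v)"
      unfolding m_def sum_distrib_left sum_subtractf[symmetric]
    proof (intro sum.cong refl)
      fix u
      have "(r u)^2 = r u * ((\<Sum>v\<in>V. a u v * w v) - l * w u)"
        unfolding power2_eq_square by (simp add: r_def)
      then show "(r u)^2 = (\<Sum>v\<in>V. r u * (a u v * w v)) - l * (r u * w u)"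
        by (simp add: sum_distrib_left[symmetric] algebra_simps)
    qed
    show ?thesis unfolding 1 2 3 by (simp add: algebra_simps)
  qed
  have "(\<Sum>u\<in>V. (r u)^2) = 0"
  proof (rule linear_coeff_zero_if_quadratic_nonneg)
    fix t :: real
    have "(\<Sum>v\<in>V. w v + t * r v) = 0"
      by (simp add: sum.distrib w0 r0 flip: sum_distrib_left)
    then show "0 \<le> 2 * t * (\<Sum>u\<in>V. (r u)^2) + t^2 * (q r - l * nn r)"
      using lower[of "\<lambda>v. w v + t * r v"] expand[of t] by linarith
  qed
  then have r: "r u = 0" if "u \<in> V" for u
    using that fin by (simp add: sum_nonneg_eq_0_iff)
  have "\<forall>u\<in>V. (\<Sum>v\<in>V. a u v * w v) = l * w u" using r by (simp add: r_def)
  then show ?thesis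
    using w0 w1 lower unfolding nn_def q_def by blast
qed

section \<open>Two independent eigenvectors bound the second smallest eigenvalue\<close>

text \<open>
  Replace columns \<open>i\<close> and \<open>j\<close> of the identity matrix by \<open>u\<close> and \<open>v\<close> and call the result \<open>Q\<close>. Its
  determinant is the minor \<open>u\<^sub>i v\<^sub>j - u\<^sub>j v\<^sub>i\<close>, so \<open>Q\<close> is
  invertible. Multiplying the characteristic matrix \<open>x I - A\<close> by \<open>Q\<close> on the right turns these two
  columns into \<open>(x - \<alpha>) u\<close> and \<open>(x - \<beta>) v\<close>, and both linear factors can be taken out of the
  determinant. For \<open>\<alpha> = \<beta>\<close> this yields a root of multiplicity at least two.
\<close>

lemma two_eigenvectors_char_poly_dvd:
  fixes A :: "'a :: field mat"
  assumes A: "A \<in> carrier_mat n n" and u: "u \<in> carrier_vec n" and v: "v \<in> carrier_vec n"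
    and eu: "A *\<^sub>v u = \<alpha> \<cdot>\<^sub>v u" and ev: "A *\<^sub>v v = \<beta> \<cdot>\<^sub>v v"
    and i: "i < n" and j: "j < n" and indep: "u $ i * v $ j \<noteq> u $ j * v $ i"
  shows "[:-\<alpha>, 1:] * [:-\<beta>, 1:] dvd char_poly A"
proof -
  have ij: "i \<noteq> j" using indep by auto
  define Q where "Q = mat n n (\<lambda>(r, c). if c = i then u $ r else if c = j then v $ r
     else if r = c then 1 else 0)"
  define P where "P = map_mat (\<lambda>a. [:a:]) Q"
  define D where "D = mat_diag n (\<lambda>c. if c = i then [:-\<alpha>, 1:] else if c = j then [:-\<beta>, 1:] else 1)"
  define R where "R = mat n n (\<lambda>(r, c). if c = i then [:u $ r:] else if c = j then [:v $ r:]
     else char_poly_matrix A $$ (r, c))"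
  have Q: "Q \<in> carrier_mat n n" and P: "P \<in> carrier_mat n n" and D: "D \<in> carrier_mat n n"
    and R: "R \<in> carrier_mat n n" by (auto simp: Q_def P_def D_def R_def)
  have M: "char_poly_matrix A \<in> carrier_mat n n" using A by simp
  interpret ph: comm_ring_hom "\<lambda>a::'a. [:a:]" by unfold_locales (auto simp: one_pCons)
  \<comment> \<open>A kernel vector vanishes at \<open>i\<close> and \<open>j\<close> by Cramer's rule, and then at all other positions.\<close>
  have detQ: "det Q \<noteq> 0"
  proof
    assume "det Q = 0"
    then obtain y where y: "y \<in> carrier_vec n" "y \<noteq> 0\<^sub>v n" "Q *\<^sub>v y = 0\<^sub>v n"
      using det_0_iff_vec_prod_zero[OF Q] by blast
    have row: "u $ r * y $ i + v $ r * y $ j + (if r = i \<or> r = j then 0 else y $ r) = 0"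
      if r: "r < n" for r
    proof -
      have "(Q *\<^sub>v y) $ r = (\<Sum>c<n. (if c = i then u $ r else if c = j then v $ r
          else if r = c then 1 else 0) * y $ c)"
        using r y(1) by (simp add: Q_def scalar_prod_def lessThan_atLeast0)
      also have "\<dots> = (\<Sum>c<n. (if c = i then u $ r * y $ i else 0) + (if c = j then v $ r * y $ j else 0)
          + (if c = r then (if r = i \<or> r = j then 0 else y $ r) else 0))"
        using ij by (intro sum.cong refl) auto
      also have "\<dots> = u $ r * y $ i + v $ r * y $ j + (if r = i \<or> r = j then 0 else y $ r)"
        using i j r by (simp add: sum.distrib)
      finally show ?thesis using y(3) r by simp
    qed
    have e1: "u $ i * y $ i + v $ i * y $ j = 0" using row[OF i] by simp
    have e2: "u $ j * y $ i + v $ j * y $ j = 0" using row[OF j] by simp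
    have "(u $ i * v $ j - u $ j * v $ i) * y $ i
        = v $ j * (u $ i * y $ i + v $ i * y $ j) - v $ i * (u $ j * y $ i + v $ j * y $ j)"
      by (simp add: algebra_simps)
    then have yi: "y $ i = 0" using indep by (simp add: e1 e2)
    have "(u $ i * v $ j - u $ j * v $ i) * y $ j
        = u $ i * (u $ j * y $ i + v $ j * y $ j) - u $ j * (u $ i * y $ i + v $ i * y $ j)"
      by (simp add: algebra_simps)
    then have yj: "y $ j = 0" using indep by (simp add: e1 e2)
    have "y = 0\<^sub>v n"
      using y(1) row yi yj by (intro eq_vecI) (force split: if_splits)+
    then show False using y(2) by simp
  qed
  have eigen: "(\<Sum>c<n. char_poly_matrix A $$ (r, c) * [:x $ c:]) = [:x $ r:] * [:-\<gamma>, 1:]"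
    if r: "r < n" and x: "x \<in> carrier_vec n" and e: "A *\<^sub>v x = \<gamma> \<cdot>\<^sub>v x" for r x \<gamma>
  proof -
    have "(\<Sum>c<n. A $$ (r, c) * x $ c) = (A *\<^sub>v x) $ r"
      using r x A by (simp add: scalar_prod_def lessThan_atLeast0)
    also have "\<dots> = \<gamma> * x $ r" using r x by (simp add: e)
    finally have s: "(\<Sum>c<n. A $$ (r, c) * x $ c) = \<gamma> * x $ r" .
    have "(\<Sum>c<n. char_poly_matrix A $$ (r, c) * [:x $ c:])
        = (\<Sum>c<n. (if c = r then [:0, x $ r:] else 0) - [:A $$ (r, c) * x $ c:])"
      using r A by (intro sum.cong refl) (auto simp: char_poly_matrix_def)
    also have "\<dots> = [:0, x $ r:] - [:\<Sum>c<n. A $$ (r, c) * x $ c:]"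
      using r by (simp add: sum_subtractf ph.hom_sum)
    also have "\<dots> = [:x $ r:] * [:-\<gamma>, 1:]" by (simp add: s)
    finally show ?thesis .
  qed
  have "char_poly_matrix A * P = R * D"
  proof (rule eq_matI)
    fix r c assume "r < dim_row (R * D)" "c < dim_col (R * D)"
    then have r: "r < n" and c: "c < n" using R D by auto
    have "(char_poly_matrix A * P) $$ (r, c) = (\<Sum>k<n. char_poly_matrix A $$ (r, k) * P $$ (k, c))"
      using M P r c by (simp add: scalar_prod_def lessThan_atLeast0)
    also have "\<dots> = R $$ (r, c) * (if c = i then [:-\<alpha>, 1:] else if c = j then [:-\<beta>, 1:] else 1)"
    proof -
      consider "c = i" | "c = j" | "c \<noteq> i" "c \<noteq> j" by blast
      then show ?thesis
      proof cases
        case 1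
        then show ?thesis using eigen[OF r u eu] r i
          by (simp add: P_def Q_def R_def)
      next
        case 2
        then show ?thesis using eigen[OF r v ev] r j ij
          by (simp add: P_def Q_def R_def)
      next
        case 3
        have "(\<Sum>k<n. char_poly_matrix A $$ (r, k) * P $$ (k, c))
            = (\<Sum>k<n. if k = c then char_poly_matrix A $$ (r, c) else 0)"
          using 3 c by (intro sum.cong refl) (auto simp: P_def Q_def one_pCons)
        then show ?thesis using 3 r c by (simp add: R_def)
      qed
    qed
    also have "\<dots> = (R * D) $$ (r, c)"
      using r c R by (simp add: D_def mat_diag_mult_right[OF R])
    finally show "(char_poly_matrix A * P) $$ (r, c) = (R * D) $$ (r, c)" .
  qed (use M P R D in auto)
  then have "char_poly A * det P = det R * det D"
    unfolding char_poly_def using det_mult[OF M P] det_mult[OF R D] by simp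
  moreover have "det P = [:det Q:]" unfolding P_def by (rule ph.hom_det)
  moreover have "det D = [:-\<alpha>, 1:] * [:-\<beta>, 1:]"
  proof -
    have "det D = prod_list (diag_mat D)"
      by (rule det_upper_triangular[OF _ D]) (auto simp: upper_triangular_def D_def mat_diag_def)
    also have "\<dots> = (\<Prod>c<n. if c = i then [:-\<alpha>, 1:] else if c = j then [:-\<beta>, 1:] else 1)"
      by (simp add: prod_list_diag_prod D_def mat_diag_def lessThan_atLeast0)
    also have "\<dots> = (\<Prod>c<n. (if c = i then [:-\<alpha>, 1:] else 1) * (if c = j then [:-\<beta>, 1:] else 1))"
      using ij by (intro prod.cong refl) auto
    also have "\<dots> = [:-\<alpha>, 1:] * [:-\<beta>, 1:]"
      using i j by (simp only: prod.distrib prod.delta) simp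
    finally show ?thesis .
  qed
  ultimately have "[:-\<alpha>, 1:] * [:-\<beta>, 1:] dvd char_poly A * [:det Q:]"
    by (simp only: dvd_triv_right)
  then have "[:-\<alpha>, 1:] * [:-\<beta>, 1:] dvd Polynomial.smult (det Q) (char_poly A)"
    by (simp only: mult_pCons_right mult_zero_right pCons_0_0 add_0_right)
  then show ?thesis using detQ by (simp add: dvd_smult_iff)
qed

text \<open>
  If the entry at position 1 exceeded \<open>c\<close>, then so would all later ones, and only position 0 could
  hold an entry that is at most \<open>c\<close>. But \<open>a\<close> and \<open>b\<close> occupy two such positions.
\<close>

lemma sorted_list_second_le:
  fixes c :: "'a :: linorder"
  assumes sub: "{#a, b#} \<subseteq># M" and "a \<le> c" "b \<le> c"
  shows "sorted_list_of_multiset M ! 1 \<le> c"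
proof (rule ccontr)
  define xs where "xs = sorted_list_of_multiset M"
  assume "\<not> ?thesis"
  then have big: "c < xs ! 1" by (simp add: xs_def)
  have sorted: "sorted xs" and M: "mset xs = M" by (simp_all add: xs_def)
  have "size (filter_mset (\<lambda>x. x \<le> c) {#a, b#}) \<le> size (filter_mset (\<lambda>x. x \<le> c) M)"
    using sub by (intro size_mset_mono multiset_filter_mono)
  then have "2 \<le> size (filter_mset (\<lambda>x. x \<le> c) M)" using assms by simp
  also have "\<dots> = card {i. i < length xs \<and> xs ! i \<le> c}"
    by (simp add: M[symmetric] length_filter_conv_card flip: mset_filter)
  also have "\<dots> \<le> card {0::nat}"
  proof (intro card_mono subsetI)
    fix i assume "i \<in> {i. i < length xs \<and> xs ! i \<le> c}"
    then have "i < length xs" "xs ! i \<le> c" by auto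
    moreover have "xs ! 1 \<le> xs ! i" if "1 \<le> i"
      using that sorted \<open>i < length xs\<close> by (intro sorted_nth_mono) auto
    ultimately show "i \<in> {0}" using big by (cases "1 \<le> i") auto
  qed simp
  finally show False by simp
qed

lemma sorted_eigenvalues_second_le:
  fixes A :: "real mat"
  assumes A: "A \<in> carrier_mat n n" and u: "u \<in> carrier_vec n" and v: "v \<in> carrier_vec n"
    and "A *\<^sub>v u = \<alpha> \<cdot>\<^sub>v u" "A *\<^sub>v v = \<beta> \<cdot>\<^sub>v v"
    and "i < n" "j < n" "u $ i * v $ j \<noteq> u $ j * v $ i"
    and "\<alpha> \<le> c" "\<beta> \<le> c"
  shows "sorted_eigenvalues A ! 1 \<le> c"
proof -
  obtain p where p: "char_poly A = [:-\<alpha>, 1:] * [:-\<beta>, 1:] * p"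
    using two_eigenvectors_char_poly_dvd[OF assms(1-8)] unfolding dvd_def by blast
  have "char_poly A \<noteq> 0" using degree_monic_char_poly[OF A] by auto
  then have "p \<noteq> 0" using p by auto
  then have "proots (char_poly A) = {#\<alpha>, \<beta>#} + proots p"
    unfolding p by (subst proots_mult | simp)+
  then show ?thesis
    unfolding sorted_eigenvalues_def using assms(9,10)
    by (intro sorted_list_second_le[of \<alpha> \<beta>]) auto
qed

section \<open>Neighbour counts and Laplacian entries\<close>

text \<open>
  The Laplacian indexed by the vertices themselves, so that sums range over the vertex set rather
  than over positions in an enumeration of it.
\<close>

definition laplacian_entry :: "'a pair_pre_digraph \<Rightarrow> 'a \<Rightarrow> 'a \<Rightarrow> real" where
  "laplacian_entry G u v =
     (if u = v then real (degree_of G u) else if (u, v) \<in> parcs G then -1 else 0)"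

lemma nbr_count_eq_sum:
  assumes "finite X"
  shows "real (nbr_count G X v) = (\<Sum>u\<in>X. of_bool ((v, u) \<in> parcs G))"
  using assms by (simp add: nbr_count_def Collect_conj_eq)

lemma nbr_count_split:
  assumes "finite V" "S \<subseteq> V"
  shows "nbr_count G V v = nbr_count G S v + nbr_count G (V - S) v"
proof -
  have "{u \<in> V. (v, u) \<in> parcs G} = {u \<in> S. (v, u) \<in> parcs G} \<union> {u \<in> V - S. (v, u) \<in> parcs G}"
    using assms by auto
  then show ?thesis
    using assms unfolding nbr_count_def
    by (subst card_Un_disjoint[symmetric]) (auto intro: finite_subset)
qed

context pair_graph
begin

abbreviation V where "V \<equiv> pverts G"

lemma finite_V: "finite V"
  by (rule pair_finite_verts)

lemma arc_commute: "(u, v) \<in> parcs G \<longleftrightarrow> (v, u) \<in> parcs G"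
proof -
  have "sym (parcs G)" using pair_sym_arcs by (simp add: symmetric_def)
  then show ?thesis by (metis symD)
qed

lemma no_loop: "(u, u) \<notin> parcs G"
  using pair_no_loops by fastforce

lemma laplacian_entry_commute: "laplacian_entry G u v = laplacian_entry G v u"
  using arc_commute by (simp add: laplacian_entry_def)

lemma laplacian_entry_alt:
  "laplacian_entry G u v = (if v = u then real (degree_of G u) else 0) - of_bool ((u, v) \<in> parcs G)"
  using no_loop by (auto simp: laplacian_entry_def)

lemma laplacian_row_sum: "u \<in> V \<Longrightarrow> (\<Sum>v\<in>V. laplacian_entry G u v) = 0"
  using finite_V
  by (simp only: laplacian_entry_alt sum_subtractf nbr_count_eq_sum[symmetric])
    (simp add: degree_of_def)

text \<open>
  Twice the form is the sum of \<open>(x u - x v)\<^sup>2\<close> over all arcs \<open>(u, v)\<close>; every edge contributes two arcs.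
\<close>

lemma laplacian_form_nonneg:
  "0 \<le> (\<Sum>u\<in>V. \<Sum>v\<in>V. laplacian_entry G u v * x u * x v)"
proof -
  define e where "e u v = (of_bool ((u, v) \<in> parcs G) :: real)" for u v
  have e: "e u v = e v u" "0 \<le> e u v" for u v using arc_commute by (auto simp: e_def)
  have deg: "real (degree_of G u) = (\<Sum>v\<in>V. e u v)" for u
    using finite_V by (simp add: degree_of_def nbr_count_eq_sum e_def)
  define d where "d = (\<Sum>u\<in>V. \<Sum>v\<in>V. e u v * (x u)^2)"
  define m where "m = (\<Sum>u\<in>V. \<Sum>v\<in>V. e u v * x u * x v)"
  have d': "(\<Sum>u\<in>V. \<Sum>v\<in>V. e u v * (x v)^2) = d"
    unfolding d_def by (subst sum.swap) (simp add: e(1))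
  have "(\<Sum>v\<in>V. laplacian_entry G u v * x u * x v) = (\<Sum>v\<in>V. e u v * (x u)^2) - (\<Sum>v\<in>V. e u v * x u * x v)"
    if u: "u \<in> V" for u
  proof -
    have "(\<Sum>v\<in>V. laplacian_entry G u v * x u * x v)
        = (\<Sum>v\<in>V. (if v = u then real (degree_of G u) * (x u)^2 else 0) - e u v * x u * x v)"
      by (intro sum.cong refl) (simp add: laplacian_entry_alt e_def power2_eq_square left_diff_distrib)
    then show ?thesis
      using u finite_V by (simp add: sum_subtractf deg sum_distrib_right)
  qed
  then have "(\<Sum>u\<in>V. \<Sum>v\<in>V. laplacian_entry G u v * x u * x v) = d - m"
    by (simp add: sum_subtractf d_def m_def)
  moreover have "0 \<le> (\<Sum>u\<in>V. \<Sum>v\<in>V. e u v * (x u - x v)^2)"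
    using e by (intro sum_nonneg) simp
  moreover have "(\<Sum>u\<in>V. \<Sum>v\<in>V. e u v * (x u - x v)^2)
      = (\<Sum>u\<in>V. \<Sum>v\<in>V. e u v * (x u)^2 + e u v * (x v)^2 - 2 * (e u v * x u * x v))"
    by (intro sum.cong refl) (simp add: power2_eq_square algebra_simps)
  moreover have "\<dots> = 2 * (d - m)"
    unfolding sum.distrib sum_subtractf sum_distrib_left[symmetric] d'
    by (simp add: d_def m_def)
  ultimately show ?thesis by simp
qed

section \<open>The Rayleigh inequality and Fiedler's cut bound\<close>

lemma vertex_list: "distinct (vertex_list G)" "set (vertex_list G) = V"
proof -
  have "distinct (vertex_list G) \<and> set (vertex_list G) = V"
    unfolding vertex_list_def
    by (rule someI_ex) (use finite_distinct_list[OF finite_V] in blast)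
  then show "distinct (vertex_list G)" "set (vertex_list G) = V" by blast+
qed

text \<open>
  Eigenvector equations carry over from vertex-indexed sums to the matrix of the enumerated vertices.
\<close>

lemma laplacian_mult_vec:
  assumes eig: "\<And>u. u \<in> V \<Longrightarrow> (\<Sum>v\<in>V. laplacian_entry G u v * x v) = l * x u"
  defines "vs \<equiv> vertex_list G"
  shows "laplacian_matrix G *\<^sub>v vec (length vs) (\<lambda>i. x (vs ! i))
    = l \<cdot>\<^sub>v vec (length vs) (\<lambda>i. x (vs ! i))"
proof (rule eq_vecI)
  have vs: "distinct vs" "set vs = V" using vertex_list by (auto simp: vs_def)
  fix i assume "i < dim_vec (l \<cdot>\<^sub>v vec (length vs) (\<lambda>i. x (vs ! i)))"
  then have i: "i < length vs" by simp
  have "(laplacian_matrix G *\<^sub>v vec (length vs) (\<lambda>i. x (vs ! i))) $ i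
      = (\<Sum>j<length vs. laplacian_entry G (vs ! i) (vs ! j) * x (vs ! j))"
    using i vs(1)
    unfolding laplacian_matrix_def Let_def vs_def[symmetric]
    by (auto simp: scalar_prod_def lessThan_atLeast0 laplacian_entry_def nth_eq_iff_index_eq
        intro!: sum.cong)
  also have "\<dots> = (\<Sum>v\<in>V. laplacian_entry G (vs ! i) v * x v)"
    by (rule sum.reindex_bij_betw[OF bij_betw_nth[OF vs(1) refl vs(2)[symmetric]]])
  also have "\<dots> = l * x (vs ! i)"
    by (rule eig) (use i vs(2) in auto)
  finally show "(laplacian_matrix G *\<^sub>v vec (length vs) (\<lambda>i. x (vs ! i))) $ i
      = (l \<cdot>\<^sub>v vec (length vs) (\<lambda>i. x (vs ! i))) $ i" using i by simp
qed (simp add: laplacian_matrix_def Let_def vs_def)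

text \<open>
  Let \<open>l\<close> be the minimum of the Rayleigh quotient, attained at \<open>w\<close>. The constant vector \<open>1\<close> has
  eigenvalue \<open>0\<close>, which is at most \<open>l\<close> since the form is nonnegative. The vector \<open>w\<close> is nonzero with
  coordinate sum \<open>0\<close>, so it takes different values at two vertices, and there the \<open>2 \<times> 2\<close> minor of
  \<open>1\<close> and \<open>w\<close> is nonzero. So the second smallest eigenvalue is at most \<open>l\<close>.
\<close>

lemma algebraic_connectivity_rayleigh:
  assumes two: "card V \<ge> 2" and x: "(\<Sum>v\<in>V. x v) = 0"
  shows "algebraic_connectivity G * (\<Sum>v\<in>V. (x v)^2)
    \<le> (\<Sum>u\<in>V. \<Sum>v\<in>V. laplacian_entry G u v * x u * x v)"
proof -
  obtain w l where w: "(\<Sum>v\<in>V. w v) = 0" "(\<Sum>v\<in>V. (w v)^2) = 1"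
    and eig: "\<And>u. u \<in> V \<Longrightarrow> (\<Sum>v\<in>V. laplacian_entry G u v * w v) = l * w u"
    and low: "\<And>x. (\<Sum>v\<in>V. x v) = 0 \<Longrightarrow>
       l * (\<Sum>v\<in>V. (x v)^2) \<le> (\<Sum>u\<in>V. \<Sum>v\<in>V. laplacian_entry G u v * x u * x v)"
    using rayleigh_minimiser_sum_zero[OF finite_V two laplacian_entry_commute laplacian_row_sum]
    by blast
  have "(\<Sum>u\<in>V. \<Sum>v\<in>V. laplacian_entry G u v * w u * w v)
      = (\<Sum>u\<in>V. w u * (\<Sum>v\<in>V. laplacian_entry G u v * w v))"
    unfolding sum_distrib_left by (intro sum.cong refl) simp
  also have "\<dots> = (\<Sum>u\<in>V. l * (w u)^2)"
    using eig by (intro sum.cong refl) (simp add: power2_eq_square)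
  also have "\<dots> = l" using w by (simp flip: sum_distrib_left)
  finally have l: "0 \<le> l" using laplacian_form_nonneg[of w] by simp
  define vs where "vs = vertex_list G"
  have vs: "distinct vs" "set vs = V" using vertex_list by (auto simp: vs_def)
  have "\<exists>i<length vs. \<exists>j<length vs. w (vs ! i) \<noteq> w (vs ! j)"
  proof (rule ccontr)
    assume "\<not> ?thesis"
    then have const: "w u = w v" if "u \<in> V" "v \<in> V" for u v
      using that vs(2) by (metis in_set_conv_nth)
    have "w v = 0" if v: "v \<in> V" for v
    proof -
      have "(\<Sum>u\<in>V. w u) = (\<Sum>u\<in>V. w v)" by (intro sum.cong refl const v)
      then show ?thesis using w(1) two v by auto
    qed
    then show False using w(2) by simp
  qed
  then obtain i j where ij: "i < length vs" "j < length vs" "w (vs ! i) \<noteq> w (vs ! j)" by blast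
  have A: "laplacian_matrix G \<in> carrier_mat (length vs) (length vs)"
    by (simp add: laplacian_matrix_def Let_def vs_def)
  have one: "(\<Sum>v\<in>V. laplacian_entry G u v * (\<lambda>_. 1) v) = 0 * (\<lambda>_. 1) u" if "u \<in> V" for u
    using laplacian_row_sum[OF that] by simp
  have "algebraic_connectivity G \<le> l"
    unfolding algebraic_connectivity_def
    using sorted_eigenvalues_second_le[OF A _ _ laplacian_mult_vec[OF one, folded vs_def]
        laplacian_mult_vec[OF eig, folded vs_def] ij(1,2) _ l order_refl] ij by simp
  then have "algebraic_connectivity G * (\<Sum>v\<in>V. (x v)^2) \<le> l * (\<Sum>v\<in>V. (x v)^2)"
    by (intro mult_right_mono sum_nonneg) auto
  then show ?thesis using low[OF x] by linarith
qed

text \<open>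
  Shifting a vector by a constant does not change the form, because rows and columns of the
  Laplacian sum to \<open>0\<close>. For the indicator vector of \<open>S\<close> itself the form is the sum of the entries
  with both indices in \<open>S\<close>; by the row sums this is minus the sum of the entries from \<open>S\<close> to the
  complement, which are \<open>-1\<close> for edges and \<open>0\<close> otherwise.
\<close>

lemma laplacian_form_indicator:
  assumes S: "S \<subseteq> V"
  shows "(\<Sum>u\<in>V. \<Sum>v\<in>V. laplacian_entry G u v * (of_bool (u \<in> S) - c) * (of_bool (v \<in> S) - c))
    = (\<Sum>v\<in>S. real (nbr_count G (V - S) v))"
proof -
  define g where "g u = (\<Sum>v\<in>S. laplacian_entry G u v)" for u
  have fS: "finite S" using S finite_V by (rule finite_subset)
  have VS: "V \<inter> S = S" using S by blast
  have inner: "(\<Sum>v\<in>V. laplacian_entry G u v * (of_bool (v \<in> S) - c)) = g u" if "u \<in> V" for u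
  proof -
    have "(\<Sum>v\<in>V. laplacian_entry G u v * (of_bool (v \<in> S) - c))
        = (\<Sum>v\<in>V. laplacian_entry G u v * of_bool (v \<in> S)) - (\<Sum>v\<in>V. laplacian_entry G u v) * c"
      by (simp add: right_diff_distrib sum_subtractf sum_distrib_right)
    also have "\<dots> = g u"
      using finite_V by (simp add: laplacian_row_sum[OF that] g_def VS)
    finally show ?thesis .
  qed
  have "(\<Sum>u\<in>V. \<Sum>v\<in>V. laplacian_entry G u v * (of_bool (u \<in> S) - c) * (of_bool (v \<in> S) - c))
      = (\<Sum>u\<in>V. (of_bool (u \<in> S) - c) * (\<Sum>v\<in>V. laplacian_entry G u v * (of_bool (v \<in> S) - c)))"
    unfolding sum_distrib_left by (intro sum.cong refl) simp
  also have "\<dots> = (\<Sum>u\<in>V. of_bool (u \<in> S) * g u - c * g u)"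
    by (intro sum.cong refl) (simp add: inner left_diff_distrib)
  also have "\<dots> = (\<Sum>u\<in>S. g u) - c * (\<Sum>u\<in>V. g u)"
    using finite_V by (simp add: sum_subtractf sum_distrib_left VS)
  also have "(\<Sum>u\<in>V. g u) = (\<Sum>v\<in>S. \<Sum>u\<in>V. laplacian_entry G v u)"
    unfolding g_def by (subst sum.swap) (simp add: laplacian_entry_commute)
  also have "\<dots> = 0"
    using S by (intro sum.neutral) (auto simp: laplacian_row_sum)
  also have "(\<Sum>u\<in>S. g u) = (\<Sum>v\<in>S. real (nbr_count G (V - S) v))"
  proof (intro sum.cong refl)
    fix u assume u: "u \<in> S"
    have "g u = - (\<Sum>v\<in>V - S. laplacian_entry G u v)"
      using laplacian_row_sum[of u] u S sum.subset_diff[OF S finite_V, of "laplacian_entry G u"]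
      by (auto simp: g_def)
    also have "\<dots> = (\<Sum>v\<in>V - S. of_bool ((u, v) \<in> parcs G))"
      unfolding sum_negf[symmetric] using u by (intro sum.cong refl) (auto simp: laplacian_entry_def)
    also have "\<dots> = real (nbr_count G (V - S) u)"
      using finite_V by (simp add: nbr_count_eq_sum)
    finally show "g u = real (nbr_count G (V - S) u)" .
  qed
  finally show ?thesis by simp
qed

lemma algebraic_connectivity_cut_bound:
  assumes two: "card V \<ge> 2" and S: "S \<subseteq> V"
  shows "algebraic_connectivity G * real (card S) * (real (card V) - real (card S))
    \<le> real (card V) * (\<Sum>v\<in>S. real (nbr_count G (V - S) v))"
proof -
  \<comment> \<open>The shift \<open>c\<close> is the mean of the indicator vector, which makes the coordinate sum \<open>0\<close>.\<close>
  define n s c where "n = real (card V)" and "s = real (card S)" and "c = s / n"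
  have n: "n > 0" using two by (simp add: n_def)
  have VS: "V \<inter> S = S" using S by blast
  have sum0: "(\<Sum>v\<in>V. of_bool (v \<in> S) - c) = 0"
    using finite_V n by (auto simp: sum_subtractf VS c_def s_def n_def)
  have "(\<Sum>v\<in>V. (of_bool (v \<in> S) - c)^2) = (\<Sum>v\<in>V. (1 - 2 * c) * of_bool (v \<in> S) + c^2)"
    by (intro sum.cong refl) (auto simp: power2_eq_square algebra_simps)
  also have "\<dots> = (1 - 2 * c) * s + n * c^2"
    using finite_V by (simp add: sum.distrib VS s_def n_def flip: sum_distrib_left)
  also have "\<dots> = s * (n - s) / n"
    using n by (simp add: c_def field_simps power2_eq_square)
  finally have "algebraic_connectivity G * (s * (n - s) / n) \<le> (\<Sum>v\<in>S. real (nbr_count G (V - S) v))"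
    using algebraic_connectivity_rayleigh[OF two sum0] laplacian_form_indicator[OF S, of c] by simp
  then show ?thesis using n by (simp add: field_simps n_def[symmetric] s_def[symmetric])
qed

text \<open>
  Otherwise the vertices of \<open>S\<close> have fewer than \<open>\<mu> |S| / 2\<close> outside neighbours in total, whereas the
  cut bound provides at least \<open>\<mu> |S| (n - |S|) / n\<close> of them, and \<open>n - |S| \<ge> n / 2\<close>.
\<close>

lemma ex_vertex_many_outside_nbrs:
  assumes two: "card V \<ge> 2" and S: "S \<subseteq> V" "S \<noteq> {}" and small: "2 * card S \<le> card V"
  obtains v where "v \<in> S" "algebraic_connectivity G / 2 \<le> real (nbr_count G (V - S) v)"
proof -
  define \<mu> where "\<mu> = algebraic_connectivity G"
  have fS: "finite S" using S finite_V by (auto intro: finite_subset)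
  have "\<exists>v\<in>S. \<mu> / 2 \<le> real (nbr_count G (V - S) v)"
  proof (rule ccontr)
    assume "\<not> ?thesis"
    then have less: "real (nbr_count G (V - S) v) < \<mu> / 2" if "v \<in> S" for v
      using that by force
    obtain v where v: "v \<in> S" using S by blast
    \<comment> \<open>The last estimate below needs \<open>\<mu> \<ge> 0\<close>, and a count smaller than \<open>\<mu> / 2\<close> provides it.\<close>
    have \<mu>: "\<mu> > 0" using less[OF v] by linarith
    have "(\<Sum>v\<in>S. real (nbr_count G (V - S) v)) < (\<Sum>v\<in>S. \<mu> / 2)"
      using less fS S by (intro sum_strict_mono) auto
    then have "real (card V) * (\<Sum>v\<in>S. real (nbr_count G (V - S) v))
        < real (card V) * (card S * (\<mu> / 2))"
      using two by (intro mult_strict_left_mono) auto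
    also have "\<dots> = \<mu> * card S * (real (card V) / 2)" by simp
    also have "\<dots> \<le> \<mu> * card S * (real (card V) - real (card S))"
      using \<mu> small by (intro mult_left_mono) auto
    finally show False
      using algebraic_connectivity_cut_bound[OF two S(1)] by (simp add: \<mu>_def)
  qed
  then show ?thesis using that by (auto simp: \<mu>_def)
qed

section \<open>Degrees and partitions\<close>

lemma nbr_count_le_max_degree:
  assumes "v \<in> V" "S \<subseteq> V"
  shows "nbr_count G S v + nbr_count G (V - S) v \<le> max_degree G"
proof -
  have "degree_of G v \<le> max_degree G"
    unfolding max_degree_def using assms(1) finite_V by (intro Max_ge) auto
  then show ?thesis
    using nbr_count_split[OF finite_V assms(2), of G v] by (simp add: degree_of_def)
qed

lemma nbr_count_less_card:
  assumes "v \<in> S" "finite S"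
  shows "nbr_count G S v + 1 \<le> card S"
proof -
  have "nbr_count G S v \<le> card (S - {v})"
    unfolding nbr_count_def using assms no_loop by (intro card_mono) auto
  moreover have "card S > 0" using assms by (auto simp: card_gt_0_iff)
  ultimately show ?thesis using assms by simp
qed

text \<open>
  Each part other than \<open>S\<close> contains a neighbour of \<open>v\<close>, and disjoint parts give different neighbours.
\<close>

lemma dominating_partition_card_le:
  assumes P: "partition_on V P" and dom: "\<And>T. T \<in> P \<Longrightarrow> dominating_set G T"
    and S: "S \<in> P" and v: "v \<in> S"
  shows "card P \<le> nbr_count G (V - S) v + 1"
proof -
  have fP: "finite P" using P finite_V by (rule finite_elements[rotated])
  have disj: "A = B" if "A \<in> P" "B \<in> P" "x \<in> A" "x \<in> B" for A B x
    using partition_onD2[OF P] that by (auto simp: disjoint_def)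
  have sub: "T \<subseteq> V" if "T \<in> P" for T using partition_onD1[OF P] that by auto
  have "\<exists>u. u \<in> T \<and> (v, u) \<in> parcs G" if T: "T \<in> P - {S}" for T
  proof -
    have "v \<in> V - T" using sub[OF S] v T disj[OF S _ v] by blast
    then have "nbr_count G T v > 0" using dom T by (auto simp: dominating_set_def)
    then show ?thesis unfolding nbr_count_def by (auto simp: card_gt_0_iff)
  qed
  then obtain f where f: "\<And>T. T \<in> P - {S} \<Longrightarrow> f T \<in> T \<and> (v, f T) \<in> parcs G" by metis
  have "inj_on f (P - {S})" using f disj by (intro inj_onI) (metis DiffD1)
  moreover have "f ` (P - {S}) \<subseteq> {u \<in> V - S. (v, u) \<in> parcs G}"
  proof
    fix u assume "u \<in> f ` (P - {S})"
    then obtain T where T: "T \<in> P - {S}" "u = f T" by blast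
    then have u: "u \<in> T" "(v, u) \<in> parcs G" using f[OF T(1)] by auto
    have "u \<notin> S" using disj[OF _ S u(1)] T(1) by blast
    then show "u \<in> {u \<in> V - S. (v, u) \<in> parcs G}" using u sub T(1) by blast
  qed
  ultimately have "card (P - {S}) \<le> nbr_count G (V - S) v"
    unfolding nbr_count_def using finite_V by (intro card_inj_on_le) auto
  then show ?thesis using S fP by simp
qed

end

lemma partition_small_part:
  assumes fin: "finite A" and P: "partition_on A P" and two: "card P \<ge> 2"
  obtains S where "S \<in> P" "2 * card S \<le> card A"
proof -
  have fP: "finite P" using two by (intro card_ge_0_finite) simp
  obtain S T where ST: "S \<in> P" "T \<in> P" "S \<noteq> T"
    using two by (metis One_nat_def Suc_1 card_le_Suc0_iff_eq fP not_less_eq_eq)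
  have sub: "S \<union> T \<subseteq> A" using ST partition_onD1[OF P] by auto
  have "S \<inter> T = {}" using partition_onD2[OF P] ST by (auto simp: disjoint_def)
  then have "card S + card T = card (S \<union> T)"
    using sub fin by (subst card_Un_disjoint) (auto intro: finite_subset)
  also have "\<dots> \<le> card A" using sub fin by (rule card_mono[rotated])
  finally show ?thesis using that ST by (cases "card S \<le> card T") fastforce+
qed

text \<open>
  Positivity excludes the default value \<open>Sup {} = 0\<close>, so the supremum is a genuine maximum.
\<close>

lemma Sup_card_partition_attained:
  fixes Q :: "'a set set \<Rightarrow> bool"
  assumes fin: "finite A" and pos: "Sup {card P |P. partition_on A P \<and> Q P} > 0"
  obtains P where "partition_on A P" "Q P" "card P = Sup {card P |P. partition_on A P \<and> Q P}"
proof -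
  define C where "C = {card P |P. partition_on A P \<and> Q P}"
  have "C \<subseteq> card ` Pow (Pow A)" by (auto simp: C_def partition_on_def)
  then have "finite C" by (rule finite_subset) (simp add: fin)
  moreover have "C \<noteq> {}" using pos unfolding C_def[symmetric] by (auto simp: Sup_nat_def)
  ultimately have "Sup C \<in> C" by (simp add: Sup_nat_def)
  then show ?thesis using that by (auto simp: C_def)
qed

section \<open>Bounds for partitions into alliances\<close>

theorem corollary10:
  fixes G :: "'a pair_pre_digraph" and k :: int
  assumes "pair_graph G"
  shows "(partitionable_gd G k \<longrightarrow>
            int (psi_gd G k) \<le>
              \<lfloor>real (max_degree G) + 1 - algebraic_connectivity G / 2 - real_of_int k\<rfloor>)
       \<and> (partitionable_d G k \<longrightarrow>
            int (alliance_number G k) \<ge>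
              \<lceil>(algebraic_connectivity G + 2 * (real_of_int k + 1)) / 2\<rceil>)"
proof -
  interpret pair_graph G by (rule assms)
  define \<mu> where "\<mu> = algebraic_connectivity G"
  have partition_card: "card V \<ge> 2" if P: "partition_on V P" "card P \<ge> 2" for P
  proof -
    obtain S where S: "S \<in> P" "2 * card S \<le> card V"
      using partition_small_part[OF finite_V P] .
    have "S \<noteq> {}" "S \<subseteq> V" using P(1) S(1) by (auto simp: partition_on_def)
    then have "card S > 0" using finite_V by (auto simp: card_gt_0_iff intro: finite_subset)
    then show ?thesis using S(2) by linarith
  qed
  have global: "int (psi_gd G k) \<le> \<lfloor>real (max_degree G) + 1 - \<mu> / 2 - real_of_int k\<rfloor>"
    if "partitionable_gd G k"
  proof -
    have psi: "psi_gd G k \<ge> 2" using that by (simp add: partitionable_gd_def)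
    obtain P where P: "partition_on V P" "\<forall>S\<in>P. global_defensive_alliance G k S"
      "card P = psi_gd G k"
      using Sup_card_partition_attained[OF finite_V,
          of "\<lambda>P. \<forall>S\<in>P. global_defensive_alliance G k S"] psi
      unfolding psi_gd_def by auto
    obtain S where S: "S \<in> P" "2 * card S \<le> card V"
      using partition_small_part[OF finite_V P(1)] psi P(3) by metis
    have def_S: "defensive_alliance G k S"
      using P(2) S(1) by (simp add: global_defensive_alliance_def)
    then have S': "S \<subseteq> V" "S \<noteq> {}" by (auto simp: defensive_alliance_def)
    obtain v where v: "v \<in> S" "\<mu> / 2 \<le> real (nbr_count G (V - S) v)"
      using ex_vertex_many_outside_nbrs[OF partition_card[OF P(1)] S' S(2)] psi P(3)
      unfolding \<mu>_def by metis
    have "card P \<le> nbr_count G (V - S) v + 1"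
      using P S(1) v(1)
      by (intro dominating_partition_card_le) (auto simp: global_defensive_alliance_def)
    moreover have "int (nbr_count G S v) \<ge> int (nbr_count G (V - S) v) + k"
      using def_S v(1) by (simp add: defensive_alliance_def)
    moreover have "nbr_count G S v + nbr_count G (V - S) v \<le> max_degree G"
      using S' v(1) by (intro nbr_count_le_max_degree) auto
    ultimately have "int (psi_gd G k) + int (nbr_count G (V - S) v) + k \<le> int (max_degree G) + 1"
      using P(3) by linarith
    then have "real_of_int (int (psi_gd G k) + int (nbr_count G (V - S) v) + k)
        \<le> real_of_int (int (max_degree G) + 1)" by (simp only: of_int_le_iff)
    then have "real_of_int (int (psi_gd G k)) \<le> real (max_degree G) + 1 - \<mu> / 2 - real_of_int k"
      using v(2) by simp
    then show ?thesis by (simp only: le_floor_iff)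
  qed
  have local: "int (alliance_number G k) \<ge> \<lceil>(\<mu> + 2 * (real_of_int k + 1)) / 2\<rceil>"
    if "partitionable_d G k"
  proof -
    have psi: "psi_d G k \<ge> 2" using that by (simp add: partitionable_d_def)
    obtain P where P: "partition_on V P" "\<forall>S\<in>P. defensive_alliance G k S" "card P = psi_d G k"
      using Sup_card_partition_attained[OF finite_V, of "\<lambda>P. \<forall>S\<in>P. defensive_alliance G k S"] psi
      unfolding psi_d_def by auto
    obtain T where T: "T \<in> P" "2 * card T \<le> card V"
      using partition_small_part[OF finite_V P(1)] psi P(3) by metis
    \<comment> \<open>A smallest alliance is no larger than the small part \<open>T\<close>, so it has at most half the vertices.\<close>
    let ?C = "{card S |S. defensive_alliance G k S}"
    have "?C \<subseteq> card ` Pow V" by (auto simp: defensive_alliance_def)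
    then have fin: "finite ?C" by (rule finite_subset) (simp add: finite_V)
    have T_in: "card T \<in> ?C" using P(2) T(1) by blast
    then have "alliance_number G k \<in> ?C"
      unfolding alliance_number_def using fin by (intro Min_in) auto
    then obtain S where S: "defensive_alliance G k S" "card S = alliance_number G k" by auto
    have "card S \<le> card T"
      unfolding S(2) alliance_number_def using fin T_in by (rule Min_le)
    then have small: "2 * card S \<le> card V" using T(2) by linarith
    have S': "S \<subseteq> V" "S \<noteq> {}" using S(1) by (auto simp: defensive_alliance_def)
    obtain v where v: "v \<in> S" "\<mu> / 2 \<le> real (nbr_count G (V - S) v)"
      using ex_vertex_many_outside_nbrs[OF partition_card[OF P(1)] S' small] psi P(3)
      unfolding \<mu>_def by metis
    have "int (nbr_count G S v) \<ge> int (nbr_count G (V - S) v) + k"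
      using S(1) v(1) by (simp add: defensive_alliance_def)
    moreover have "nbr_count G S v + 1 \<le> card S"
      using v(1) S'(1) finite_V by (intro nbr_count_less_card) (auto intro: finite_subset)
    ultimately have "int (nbr_count G (V - S) v) + k + 1 \<le> int (alliance_number G k)"
      using S(2) by linarith
    then have "real_of_int (int (nbr_count G (V - S) v) + k + 1)
        \<le> real_of_int (int (alliance_number G k))" by (simp only: of_int_le_iff)
    then have "(\<mu> + 2 * (real_of_int k + 1)) / 2 \<le> real_of_int (int (alliance_number G k))"
      using v(2) by simp
    then show ?thesis by (simp only: ceiling_le_iff)
  qed
  show ?thesis using global local unfolding \<mu>_def by blast
qed

end
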